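(* For every $x \in [0,1]$, the single-observation-period algorithm $\mathbf{SOP}[x] = (\mathrm{SOP}[x]_n)_{n\in\mathbb{N}}$ for the Repeated Prophet Inequality satisfies $\mathrm{perf}(\mathbf{SOP}[x]) \le 0.450$.
   Context: Repeated Prophet Inequality. An adversary chooses $2n$ items with values $v_1 \ge v_2 \ge \dots \ge v_{2n} \ge 0$ (the instance $\bm v$), and $\sigma$ is a uniformly random permutation of $\{1,\dots,2n\}$. In Phase 1 the items $v_{\sigma(1)},\dots,v_{\sigma(n)}$ are presented one by one to a decision maker (DM); in Phase 2 the items $v_{\sigma(n+1)},\dots,v_{\sigma(2n)}$ are presented one by one. When an item arrives, the DM does not see its numerical value but learns its relative ranking among all items revealed to her so far (in both phases; ties are broken by an arbitrary rule, fixed and public in advance, consistent with the relative ranks revealed). She must then irrevocably accept it, which ends the current phase (no more items of that phase are revealed), or reject it forever and proceed to the next item of the phase, if any. If no item is accepted in a phase, she gets value $0$ in that phase. An algorithm is a family $\mathbf{ALG} = (\mathrm{ALG}_n)_{n\in\mathbb{N}}$, where $\mathrm{ALG}_n$ describes how the DM (who knows $n$) acts on instances with $2n$ items; $\mathrm{ALG}_n(\bm v)$ denotes the random sum of the values accepted in the two phases. Its limit performance is $$\mathrm{perf}(\mathbf{ALG}) = \liminf_{n\to\infty} \inf_{\bm v} \frac{\mathbb{E}(\mathrm{ALG}_n(\bm v))}{\mathbb{E}\left(\max\{v_{\sigma(i)} : 1\le i\le n\} + \max\{v_{\sigma(i)} : n+1\le i\le 2n\}\right)},$$ the infimum being over instances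 of $2n$ items for which the ratio is defined (not all values zero). Algorithm $\mathbf{SOP}[x]$. On $2n$ items, $\mathrm{SOP}[x]_n$ observes but does not accept the first $\lceil xn\rceil$ items (the observation stage). During the rest of Phase 1, each new item is compared only with the items of the observation stage, and the first item whose value is larger than all of them is accepted. During Phase 2, likewise, each item is compared only with the items of the observation stage, and the first item larger than all of them is accepted (in particular it need not be larger than an item accepted in Phase 1). *)

theory Defs
  imports "HOL-Probability.Probability" "HOL-Combinatorics.Combinatorics"
begin

text \<open>
  Items and arrival times are both numbered from 0: on instances with \<open>2 * n\<close> items, item \<open>i\<close> has
  value \<open>v i\<close> for \<open>i < 2 * n\<close>, the item arriving at time \<open>t\<close> is \<open>\<sigma> t\<close>, Phase 1 consists of the
  times \<open>t < n\<close> and Phase 2 of the times \<open>n \<le> t < 2 * n\<close>.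
\<close>

definition instances :: "nat \<Rightarrow> (nat \<Rightarrow> real) set" where
  "instances n = {v. antimono_on {..<2 * n} v \<and> (\<forall>i<2 * n. 0 \<le> v i) \<and> (\<exists>i<2 * n. v i \<noteq> 0)}"

definition arrivals :: "nat \<Rightarrow> (nat \<Rightarrow> nat) pmf" where
  "arrivals n = pmf_of_set {\<sigma>. \<sigma> permutes {..<2 * n}}"

text \<open>
  A tie-breaking rule is a strict linear order on the items, which may depend on the arrival order
  (so that "the earlier item wins" is covered as well as "the item with the smaller index wins").
  \<open>(i, j) \<in> T n \<sigma>\<close> means that \<open>i\<close> is ranked below \<open>j\<close> if they have the same value.
\<close>

type_synonym tie_rule = "nat \<Rightarrow> (nat \<Rightarrow> nat) \<Rightarrow> nat rel"

definition is_tie_rule :: "tie_rule \<Rightarrow> bool" where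
  "is_tie_rule T \<longleftrightarrow>
     (\<forall>n \<sigma>. \<sigma> permutes {..<2 * n} \<longrightarrow> strict_linear_order_on {..<2 * n} (T n \<sigma>))"

text \<open>
  The relative ranking of the items that arrived at the times in \<open>R\<close>, expressed through these
  times only: \<open>(s, t)\<close> belongs to it iff the item arriving at \<open>s\<close> is ranked below the one at \<open>t\<close>.
\<close>

definition ranking :: "tie_rule \<Rightarrow> nat \<Rightarrow> (nat \<Rightarrow> real) \<Rightarrow> (nat \<Rightarrow> nat) \<Rightarrow> nat set \<Rightarrow> nat rel" where
  "ranking T n v \<sigma> R = {(s, t). s \<in> R \<and> t \<in> R \<and>
     (v (\<sigma> s) < v (\<sigma> t) \<or> v (\<sigma> s) = v (\<sigma> t) \<and> (\<sigma> s, \<sigma> t) \<in> T n \<sigma>)}"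

text \<open>
  \<open>A n t r\<close> tells whether the decision maker accepts the item arriving at time \<open>t\<close> when \<open>r\<close> is the
  relative ranking of all items revealed so far, including the present one.  Together with \<open>t\<close>,
  \<open>r\<close> determines the set of revealed times, hence also the time of acceptance in Phase 1.
\<close>

type_synonym algorithm = "nat \<Rightarrow> nat \<Rightarrow> nat rel \<Rightarrow> bool"

definition stop1 :: "tie_rule \<Rightarrow> algorithm \<Rightarrow> nat \<Rightarrow> (nat \<Rightarrow> real) \<Rightarrow> (nat \<Rightarrow> nat) \<Rightarrow> nat option" where
  "stop1 T A n v \<sigma> = find (\<lambda>t. A n t (ranking T n v \<sigma> {..t})) [0..<n]"

definition revealed1 :: "tie_rule \<Rightarrow> algorithm \<Rightarrow> nat \<Rightarrow> (nat \<Rightarrow> real) \<Rightarrow> (nat \<Rightarrow> nat) \<Rightarrow> nat set" where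
  "revealed1 T A n v \<sigma> = (case stop1 T A n v \<sigma> of None \<Rightarrow> {..<n} | Some t \<Rightarrow> {..t})"

definition stop2 :: "tie_rule \<Rightarrow> algorithm \<Rightarrow> nat \<Rightarrow> (nat \<Rightarrow> real) \<Rightarrow> (nat \<Rightarrow> nat) \<Rightarrow> nat option" where
  "stop2 T A n v \<sigma> =
     find (\<lambda>t. A n t (ranking T n v \<sigma> (revealed1 T A n v \<sigma> \<union> {n..t}))) [n..<2 * n]"

definition accepted_value :: "(nat \<Rightarrow> real) \<Rightarrow> (nat \<Rightarrow> nat) \<Rightarrow> nat option \<Rightarrow> real" where
  "accepted_value v \<sigma> w = (case w of None \<Rightarrow> 0 | Some t \<Rightarrow> v (\<sigma> t))"

definition reward :: "tie_rule \<Rightarrow> algorithm \<Rightarrow> nat \<Rightarrow> (nat \<Rightarrow> real) \<Rightarrow> (nat \<Rightarrow> nat) \<Rightarrow> real" where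
  "reward T A n v \<sigma> =
     accepted_value v \<sigma> (stop1 T A n v \<sigma>) + accepted_value v \<sigma> (stop2 T A n v \<sigma>)"

definition prophet :: "nat \<Rightarrow> (nat \<Rightarrow> real) \<Rightarrow> (nat \<Rightarrow> nat) \<Rightarrow> real" where
  "prophet n v \<sigma> = Max ((\<lambda>t. v (\<sigma> t)) ` {..<n}) + Max ((\<lambda>t. v (\<sigma> t)) ` {n..<2 * n})"

definition perf :: "tie_rule \<Rightarrow> algorithm \<Rightarrow> ereal" where
  "perf T A = liminf (\<lambda>n. INF v\<in>instances n.
     ereal (measure_pmf.expectation (arrivals n) (reward T A n v)
          / measure_pmf.expectation (arrivals n) (prophet n v)))"

text \<open>
  The observation stage consists of the times \<open>s < \<lceil>x * n\<rceil>\<close>.  For \<open>x \<in> {0..1}\<close> it lies within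
  Phase 1, and its items are always revealed since none of them is accepted.
\<close>

definition SOP :: "real \<Rightarrow> algorithm" where
  "SOP x n t r \<longleftrightarrow> nat \<lceil>x * real n\<rceil> \<le> t \<and> (\<forall>s<nat \<lceil>x * real n\<rceil>. (s, t) \<in> r)"

end

theory Submission imports Defs begin

text \<open>
  It suffices to consider instances in which one item has value \<open>1\<close> and the others have values at
  most \<open>1 / n\<close>, all distinct so that the tie-breaking rule plays no role.  With \<open>k\<close> observed items,
  the best item is accepted at a time \<open>t\<close> only if it arrives then and the best of the other items
  seen so far (all of the observed ones and the rejected ones of the current phase) was an observed
  one, which has probability \<open>k / (2 * n * r)\<close> for \<open>r\<close> such other items.  Summing over \<open>t\<close> and
  writing \<open>w = n / k\<close>, the best item is accepted with probability at most
  \<open>ln (w * (w + 1)) / (2 * w) + 1 / n\<close>, and \<open>ln (w * (w + 1)) / w \<le> 0.9\<close> for all \<open>w \<ge> 1\<close>.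
\<close>

section \<open>Estimates for logarithms and harmonic sums\<close>

text \<open>The number is \<open>11 / 6 * (17 / 6)\<close>, that is \<open>w * (w + 1)\<close> at
  the point of tangency used below. The tangent slopes \<open>6 / 11\<close> and
  \<open>6 / 17\<close> add up to \<open>168 / 187\<close>, slightly less than 0.9. So
  \<open>w = 1\<close> is the tightest case there, and it needs this logarithm to be at most
  1.64866...; the bound 1.6486 lies just below.\<close>

lemma ln_187_36_le: "ln (187 / 36 :: real) \<le> 1.6486"
proof -
  have "(187 / 36 :: real) \<le> (\<Sum>m<10. 1.6486 ^ m / fact m)"
    by (simp add: lessThan_nat_numeral fact_numeral power_divide)
  also have "\<dots> = (\<Sum>m<10. inverse (fact m) *\<^sub>R 1.6486 ^ m)"
    by (simp add: field_simps)
  also have "\<dots> \<le> exp 1.6486"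
    unfolding exp_def by (intro sum_le_suminf summable_exp_generic) auto
  finally have "ln (187 / 36 :: real) \<le> ln (exp 1.6486)"
    by (subst ln_le_cancel_iff) auto
  then show ?thesis by simp
qed

lemma ln_tangent:
  fixes w c :: real
  assumes "0 < w" "0 < c"
  shows "ln w \<le> ln c + w / c - 1"
proof -
  have "ln (w / c) \<le> w / c - 1"
    using assms by (intro ln_le_minus_one) simp
  with assms show ?thesis
    by (simp add: ln_div)
qed

text \<open>The tangents at \<open>11 / 6\<close>, which is close to the minimiser of \<open>0.9 * w - ln (w * (w + 1))\<close>.\<close>

lemma ln_mult_succ_le:
  fixes w :: real
  assumes "1 \<le> w"
  shows "ln (w * (w + 1)) \<le> 0.9 * w"
proof -
  have "ln (11 / 6 * (17 / 6) :: real) = ln (11 / 6) + ln (17 / 6)"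
    by (rule ln_mult_pos) auto
  moreover have "ln (w * (w + 1)) = ln w + ln (w + 1)"
    using assms by (intro ln_mult_pos) auto
  ultimately show ?thesis
    using ln_tangent[of w "11 / 6"] ln_tangent[of "w + 1" "17 / 6"] ln_187_36_le assms
    by (simp add: field_simps)
qed

lemma sum_inverse_le_ln:
  assumes "0 < a" "a \<le> b"
  shows "(\<Sum>t = a..<b. 1 / real t) \<le> 1 / real a + ln (real b / real a)"
proof -
  \<comment> \<open>The extra \<open>- 1 / real b\<close> carries the induction: the step then
    compares the logarithmic increment with \<open>1 / real (Suc b)\<close>, whereas the summand
    \<open>1 / real b\<close> would exceed it.\<close>
  have "(\<Sum>t = a..<b. 1 / real t) \<le> 1 / real a - 1 / real b + ln (real b / real a)"
    using assms(2)
  proof (induction b rule: dec_induct)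
    case base
    then show ?case using assms by simp
  next
    case (step b)
    have "ln (real b / real (Suc b)) \<le> real b / real (Suc b) - 1"
      using step assms by (intro ln_le_minus_one) simp
    also have "\<dots> = - (1 / real (Suc b))"
      by (simp add: field_simps)
    finally have "1 / real (Suc b) \<le> ln (real (Suc b) / real a) - ln (real b / real a)"
      using step assms by (simp add: ln_div)
    with step show ?case by simp
  qed
  also have "\<dots> \<le> 1 / real a + ln (real b / real a)" by simp
  finally show ?thesis .
qed

section \<open>Counting permutations by the position of a minimum\<close>

text \<open>By symmetry under transpositions, the minimum over \<open>R\<close> is equally likely to be attained at
  each element of \<open>R\<close>.\<close>

lemma card_minimum_in:
  fixes A :: "('a \<Rightarrow> 'b :: linorder) set"
  assumes "finite A" "finite R" "R \<noteq> {}" "K \<subseteq> R"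
    and inj: "\<And>\<sigma>. \<sigma> \<in> A \<Longrightarrow> inj_on \<sigma> R"
    and closed: "\<And>\<sigma> s s'. \<sigma> \<in> A \<Longrightarrow> s \<in> R \<Longrightarrow> s' \<in> R \<Longrightarrow> \<sigma> \<circ> Transposition.transpose s s' \<in> A"
  shows "card {\<sigma> \<in> A. \<exists>s\<in>K. \<forall>r\<in>R. \<sigma> s \<le> \<sigma> r} * card R = card K * card A"
proof -
  define F where "F s = {\<sigma> \<in> A. \<forall>r\<in>R. \<sigma> s \<le> \<sigma> r}" for s
  have finF: "finite (F s)" for s
    using assms(1) by (simp add: F_def)
  have le: "card (F s) \<le> card (F s')" if "s \<in> R" "s' \<in> R" for s s'
  proof (rule card_inj_on_le)
    show "inj_on (\<lambda>\<sigma>. \<sigma> \<circ> Transposition.transpose s s') (F s)"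
      by (rule inj_onI) (metis comp_assoc comp_id transpose_comp_involutory)
    show "(\<lambda>\<sigma>. \<sigma> \<circ> Transposition.transpose s s') ` F s \<subseteq> F s'"
      using that closed by (auto simp: F_def Transposition.transpose_def)
  qed (rule finF)
  have disj: "F s \<inter> F s' = {}" if "s \<in> R" "s' \<in> R" "s \<noteq> s'" for s s'
    using that inj by (fastforce simp: F_def inj_on_def dest: antisym)
  have card_UN: "card (\<Union>s\<in>S. F s) = (\<Sum>s\<in>S. card (F s))" if "S \<subseteq> R" for S
    using that assms(2) finF disj
    by (intro card_UN_disjoint) (auto dest: finite_subset, blast)
  obtain s0 where s0: "s0 \<in> R" using assms by blast
  have eq: "card (F s) = card (F s0)" if "s \<in> R" for s
    using le s0 that by (meson le_antisym)
  have sum: "card (\<Union>s\<in>S. F s) = card S * card (F s0)" if "S \<subseteq> R" for S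
    using card_UN[OF that] eq that by (simp add: subset_iff)
  have "A = (\<Union>s\<in>R. F s)"
  proof -
    have "\<exists>s\<in>R. \<forall>r\<in>R. \<sigma> s \<le> \<sigma> r" for \<sigma> :: "'a \<Rightarrow> 'b"
      using assms(2,3) by (intro bexI[of _ "arg_min_on \<sigma> R"])
        (auto intro: arg_min_least arg_min_if_finite)
    then show ?thesis unfolding F_def by blast
  qed
  then have "card A = card R * card (F s0)" using sum[of R] by simp
  moreover have "{\<sigma> \<in> A. \<exists>s\<in>K. \<forall>r\<in>R. \<sigma> s \<le> \<sigma> r} = (\<Union>s\<in>K. F s)"
    by (auto simp: F_def)
  ultimately show ?thesis using sum[OF assms(4)] by simp
qed

text \<open>As 0 is the least value taken, \<open>\<sigma> t = 0\<close> says that the minimum over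
  all positions is attained at \<open>t\<close>, so \<open>card_minimum_in\<close> applies with
  \<open>R = {..<N}\<close>.\<close>

lemma card_permutes_zero_at:
  assumes "t < N"
  shows "card {\<sigma>. \<sigma> permutes {..<N} \<and> \<sigma> t = 0} * N = card {\<sigma>. \<sigma> permutes {..<N}}"
proof -
  have "{\<sigma>. \<sigma> permutes {..<N} \<and> \<sigma> t = 0} =
      {\<sigma> \<in> {\<sigma>. \<sigma> permutes {..<N}}. \<exists>s\<in>{t}. \<forall>r\<in>{..<N}. \<sigma> s \<le> \<sigma> r}"
  proof (intro Collect_cong iffI; clarsimp)
    fix \<sigma> assume \<sigma>: "\<sigma> permutes {..<N}" and min: "\<forall>r\<in>{..<N}. \<sigma> t \<le> \<sigma> r"
    have "inv \<sigma> 0 < N"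
      using permutes_in_image[OF permutes_inv[OF \<sigma>], of 0] assms by auto
    with min have "\<sigma> t \<le> \<sigma> (inv \<sigma> 0)" by blast
    then show "\<sigma> t = 0"
      using permutes_inverses(1)[OF \<sigma>] by simp
  qed
  then show ?thesis
    using assms card_minimum_in[of "{\<sigma>. \<sigma> permutes {..<N}}" "{..<N}" "{t}"]
    by (auto simp: finite_permutations permutes_inj_on permutes_compose permutes_swap_id)
qed

text \<open>Since \<open>t\<close> lies outside \<open>R\<close>, transpositions within
  \<open>R\<close> preserve \<open>\<sigma> t = 0\<close>. Hence the place of the minimum over
  \<open>R\<close> remains uniform given that item 0 arrives at \<open>t\<close>.\<close>

lemma card_permutes_zero_at_minimum_in:
  assumes "t < N" "R \<subseteq> {..<N} - {t}" "R \<noteq> {}" "K \<subseteq> R"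
  shows "real (card {\<sigma>. \<sigma> permutes {..<N} \<and> \<sigma> t = 0 \<and> (\<exists>s\<in>K. \<forall>r\<in>R. \<sigma> s \<le> \<sigma> r)}) =
    real (card K) / (real N * real (card R)) * real (card {\<sigma>. \<sigma> permutes {..<N}})"
proof -
  let ?A = "{\<sigma>. \<sigma> permutes {..<N} \<and> \<sigma> t = 0}"
  have "finite R" using assms(2) finite_subset by blast
  then have "card {\<sigma> \<in> ?A. \<exists>s\<in>K. \<forall>r\<in>R. \<sigma> s \<le> \<sigma> r} * card R = card K * card ?A"
    using assms
    by (intro card_minimum_in)
      (auto simp: finite_permutations permutes_inj_on intro!: permutes_compose permutes_swap_id
        simp: Transposition.transpose_def)
  moreover have "{\<sigma> \<in> ?A. \<exists>s\<in>K. \<forall>r\<in>R. \<sigma> s \<le> \<sigma> r} =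
      {\<sigma>. \<sigma> permutes {..<N} \<and> \<sigma> t = 0 \<and> (\<exists>s\<in>K. \<forall>r\<in>R. \<sigma> s \<le> \<sigma> r)}"
    by auto
  moreover note card_permutes_zero_at[OF assms(1), symmetric]
  moreover have "card R > 0" using \<open>finite R\<close> assms(3) by (simp add: card_gt_0_iff)
  ultimately show ?thesis
    using assms(1) by (simp add: field_simps flip: of_nat_mult)
qed

section \<open>The probability of accepting the best item in a phase\<close>

lemma find_upt_SomeD:
  assumes "find P [a..<b] = Some t"
  shows "a \<le> t" "t < b" "P t" "\<And>u. a \<le> u \<Longrightarrow> u < t \<Longrightarrow> \<not> P u"
proof -
  obtain i where i: "i < b - a" "P ([a..<b] ! i)" "t = [a..<b] ! i"
    and before: "\<And>j. j < i \<Longrightarrow> \<not> P ([a..<b] ! j)"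
    using assms unfolding find_Some_iff length_upt by blast
  then have t: "t = a + i" by simp
  with i show "a \<le> t" "t < b" "P t" by auto
  fix u assume "a \<le> u" "u < t"
  with before[of "u - a"] i t show "\<not> P u" by simp
qed

text \<open>Smaller numbers stand for better items, and the search interval \<open>[a..<b]\<close>
  can be either phase. \<open>c\<close> is the first time at which the rule can accept. A union
  bound over the arrival time of item 0 yields a harmonic sum starting at \<open>1 / k\<close>,
  hence the logarithm; the summand 1 pays for this first term, and for the whole case
  \<open>k = 0\<close>.\<close>

lemma card_find_zero_le:
  fixes k a b N :: nat
  assumes "b \<le> N" "k \<le> b" "a < b"
  defines "c \<equiv> max a k"
  shows "real (card {\<sigma>. \<sigma> permutes {..<N} \<and>
      (\<exists>t. find (\<lambda>t. k \<le> t \<and> (\<forall>s<k. \<sigma> t < \<sigma> s)) [a..<b] = Some t \<and> \<sigma> t = 0)})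
    \<le> (1 + real k * ln (real (k + b - c) / real k)) / real N * real (card {\<sigma>. \<sigma> permutes {..<N}})"
    (is "real (card ?E) \<le> _ * ?P")
proof (cases "k = 0")
  case True
  \<comment> \<open>With nothing observed, the comparison is vacuous and the search stops at
    \<open>a\<close>.\<close>
  have "?E \<subseteq> {\<sigma>. \<sigma> permutes {..<N} \<and> \<sigma> a = 0}"
    using True assms by (auto simp: upt_conv_Cons)
  then have "card ?E \<le> card {\<sigma>. \<sigma> permutes {..<N} \<and> \<sigma> a = 0}"
    by (intro card_mono) (auto simp: finite_permutations)
  then have "real (card ?E) \<le> ?P / real N"
    using card_permutes_zero_at[of a N, symmetric] assms by simp
  then show ?thesis using True by simp
next
  case False
  \<comment> \<open>If the search stops at \<open>t\<close>, these are the observed times and the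
    rejected times of this search. Starting at \<open>c\<close> rather than \<open>a\<close> keeps
    the two sets disjoint.\<close>
  define R where "R t = {..<k} \<union> {c..<t}" for t
  define Z where "Z t = {\<sigma>. \<sigma> permutes {..<N} \<and> \<sigma> t = 0 \<and>
    (\<exists>s\<in>{..<k}. \<forall>r\<in>R t. \<sigma> s \<le> \<sigma> r)}" for t
  have c: "k \<le> c" "a \<le> c" "c \<le> b" using assms by (auto simp: c_def)
  have card_R: "card (R t) = k + t - c" if "c \<le> t" for t
    using that c unfolding R_def by (subst card_Un_disjoint) auto
  have "?E \<subseteq> (\<Union>t\<in>{c..<b}. Z t)"
  proof clarsimp
    fix \<sigma> t
    assume \<sigma>: "\<sigma> permutes {..<N}" "\<sigma> t = 0"
      and f: "find (\<lambda>t. k \<le> t \<and> (\<forall>s<k. \<sigma> t < \<sigma> s)) [a..<b] = Some t"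
    from f have t: "a \<le> t" "t < b" "k \<le> t"
      and before: "\<And>u. a \<le> u \<Longrightarrow> u < t \<Longrightarrow> \<not> (k \<le> u \<and> (\<forall>s<k. \<sigma> u < \<sigma> s))"
      using find_upt_SomeD[OF f] by blast+
    obtain s where s: "s < k" "\<And>r. r < k \<Longrightarrow> \<sigma> s \<le> \<sigma> r"
      using False arg_min_least[of "{..<k}" _ \<sigma>] arg_min_if_finite(1)[of "{..<k}" \<sigma>]
      by auto
    \<comment> \<open>A rejected item is no better than some observed one, hence no better than the
      best observed one, which arrived at \<open>s\<close>.\<close>
    have "\<sigma> s \<le> \<sigma> r" if "r \<in> R t" for r
    proof (cases "r < k")
      case False
      with that have "a \<le> r" "r < t" "k \<le> r" using c by (auto simp: R_def)
      with before obtain s' where "s' < k" "\<sigma> s' \<le> \<sigma> r" by (meson not_less)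
      with s show ?thesis by (meson order_trans)
    qed (use s in auto)
    with s \<sigma> have "\<sigma> \<in> Z t" by (auto simp: Z_def)
    with t show "\<exists>t\<in>{c..<b}. \<sigma> \<in> Z t" by (auto simp: c_def)
  qed
  then have "card ?E \<le> card (\<Union>t\<in>{c..<b}. Z t)"
    by (intro card_mono) (auto simp: Z_def finite_permutations)
  also have "\<dots> \<le> (\<Sum>t\<in>{c..<b}. card (Z t))"
    by (intro card_UN_le) simp
  finally have "real (card ?E) \<le> (\<Sum>t\<in>{c..<b}. real (card (Z t)))"
    by (simp flip: of_nat_sum)
  also have "\<dots> = (\<Sum>t\<in>{c..<b}. real k / real N * ?P * (1 / real (k + t - c)))"
  proof (rule sum.cong)
    fix t assume "t \<in> {c..<b}"
    then show "real (card (Z t)) = real k / real N * ?P * (1 / real (k + t - c))"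
      unfolding Z_def using c False assms
      by (subst card_permutes_zero_at_minimum_in) (auto simp: card_R, auto simp: R_def)
  qed simp
  also have "\<dots> = real k / real N * ?P * (\<Sum>t\<in>{c..<b}. 1 / real (k + t - c))"
    by (simp add: sum_distrib_left)
  also have "(\<Sum>t\<in>{c..<b}. 1 / real (k + t - c)) = (\<Sum>j = k..<k + b - c. 1 / real j)"
    using c by (intro sum.reindex_bij_witness[of _ "\<lambda>j. j + c - k" "\<lambda>t. k + t - c"]) auto
  also have "real k / real N * ?P * \<dots> \<le>
      real k / real N * ?P * (1 / real k + ln (real (k + b - c) / real k))"
    using c False by (intro mult_left_mono sum_inverse_le_ln) auto
  also have "\<dots> = (1 + real k * ln (real (k + b - c) / real k)) / real N * ?P"
    using False assms by (simp add: field_simps)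
  finally show ?thesis .
qed

section \<open>The hard instance and the behaviour of \<open>SOP\<close> on it\<close>

text \<open>For positive \<open>n\<close> this is strictly decreasing in \<open>i\<close>, so
  comparing values amounts to comparing indices in reverse; this is why the counting above is about
  minima of \<open>\<sigma>\<close>.\<close>

definition steep_instance :: "nat \<Rightarrow> nat \<Rightarrow> real" where
  "steep_instance n i = 1 / (1 + real n * real i)"

lemma steep_instance_less_iff:
  "0 < n \<Longrightarrow> steep_instance n i < steep_instance n j \<longleftrightarrow> j < i"
  by (simp add: steep_instance_def divide_less_eq less_divide_eq add_pos_nonneg)

lemma steep_instance_eq_iff:
  "0 < n \<Longrightarrow> steep_instance n i = steep_instance n j \<longleftrightarrow> i = j"
  using steep_instance_less_iff[of n i j] steep_instance_less_iff[of n j i] by (metis less_irrefl nat_neq_iff)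

lemma steep_instance_pos: "0 < steep_instance n i"
  by (simp add: steep_instance_def add_pos_nonneg)

lemma steep_instance_in_instances:
  assumes "0 < n"
  shows "steep_instance n \<in> instances n"
proof -
  have "steep_instance n j \<le> steep_instance n i" if "i \<le> j" for i j
    using that steep_instance_less_iff[OF assms, of i j] by linarith
  moreover have "steep_instance n 0 \<noteq> 0"
    using steep_instance_pos[of n 0] by simp
  ultimately show ?thesis
    using assms steep_instance_pos[of n]
    by (auto simp: instances_def monotone_on_def intro: less_imp_le intro!: exI[of _ 0])
qed

lemma accepted_value_steep_instance_le:
  assumes "0 < n"
  shows "accepted_value (steep_instance n) \<sigma> w
    \<le> of_bool (\<exists>t. w = Some t \<and> \<sigma> t = 0) + 1 / real n"
proof (cases w)
  case (Some t)
  show ?thesis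
  proof (cases "\<sigma> t = 0")
    case False
    then have "real n * 1 \<le> real n * real (\<sigma> t)" by (intro mult_left_mono) auto
    then have "steep_instance n (\<sigma> t) \<le> 1 / real n"
      unfolding steep_instance_def using assms by (intro frac_le) linarith+
    with Some False show ?thesis by (simp add: accepted_value_def)
  qed (use Some in \<open>simp add: accepted_value_def steep_instance_def\<close>)
qed (simp add: accepted_value_def)

lemma accepted_value_steep_instance_nonneg: "0 \<le> accepted_value (steep_instance n) \<sigma> w"
  using steep_instance_pos[of n] by (auto simp: accepted_value_def less_imp_le split: option.split)

text \<open>During the observation stage both sides are false, so \<open>R\<close> has to contain
  all observed times only once that stage is over.\<close>

lemma SOP_ranking_steep_instance:
  fixes x :: real
  defines "k \<equiv> \<lambda>n. nat \<lceil>x * real n\<rceil>"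
  assumes "0 < n" "inj \<sigma>" "t \<in> R" "k n \<le> t \<Longrightarrow> {..<k n} \<subseteq> R"
  shows "SOP x n t (ranking T n (steep_instance n) \<sigma> R) \<longleftrightarrow>
    k n \<le> t \<and> (\<forall>s<k n. \<sigma> t < \<sigma> s)"
  using assms
  by (auto simp: SOP_def ranking_def steep_instance_less_iff steep_instance_eq_iff inj_eq
      simp del: nat_ceiling_le_eq)

lemma stop1_SOP_steep_instance:
  fixes x :: real
  defines "k \<equiv> \<lambda>n. nat \<lceil>x * real n\<rceil>"
  assumes "0 < n" "inj \<sigma>"
  shows "stop1 T (SOP x) n (steep_instance n) \<sigma> =
    find (\<lambda>t. k n \<le> t \<and> (\<forall>s<k n. \<sigma> t < \<sigma> s)) [0..<n]"
  unfolding stop1_def k_def using assms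
  by (intro find_cong refl) (subst SOP_ranking_steep_instance, auto simp del: nat_ceiling_le_eq)

lemma stop2_SOP_steep_instance:
  fixes x :: real
  defines "k \<equiv> \<lambda>n. nat \<lceil>x * real n\<rceil>"
  assumes "0 < n" "inj \<sigma>" "k n \<le> n"
  shows "stop2 T (SOP x) n (steep_instance n) \<sigma> =
    find (\<lambda>t. k n \<le> t \<and> (\<forall>s<k n. \<sigma> t < \<sigma> s)) [n..<2 * n]"
proof -
  \<comment> \<open>A stop in Phase 1 happens at some \<open>t\<close> with
    \<open>k n \<le> t\<close>; without a stop all of \<open>{..<n}\<close> is revealed.\<close>
  have "{..<k n} \<subseteq> revealed1 T (SOP x) n (steep_instance n) \<sigma>"
    using assms
    by (auto simp: revealed1_def stop1_SOP_steep_instance find_Some_iff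
        simp del: nat_ceiling_le_eq split: option.split)
  then show ?thesis
    unfolding stop2_def using assms
    by (intro find_cong refl) (subst SOP_ranking_steep_instance, auto simp: k_def)
qed

section \<open>Expected reward, expected prophet value and the limit\<close>

lemma expectation_arrivals:
  fixes f :: "(nat \<Rightarrow> nat) \<Rightarrow> real"
  shows "measure_pmf.expectation (arrivals n) f =
    (\<Sum>\<sigma> | \<sigma> permutes {..<2 * n}. f \<sigma>) / real (card {\<sigma>. \<sigma> permutes {..<2 * n}})"
  unfolding arrivals_def
  by (subst integral_pmf_of_set) (auto simp: finite_permutations intro: permutes_id)

lemma card_permutations_pos: "0 < card {\<sigma>. \<sigma> permutes {..<N :: nat}}"
  by (auto simp: card_gt_0_iff finite_permutations intro: permutes_id)

lemma expectation_reward_SOP_le: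
  fixes x :: real
  assumes "x \<in> {0..1}" "0 < n"
  shows "measure_pmf.expectation (arrivals n) (reward T (SOP x) n (steep_instance n))
    \<le> 0.45 + 3 / real n"
proof -
  define k where "k = nat \<lceil>x * real n\<rceil>"
  have "x * real n \<le> real n" using assms by (simp add: mult_left_le_one_le)
  then have k: "k \<le> n" unfolding k_def by (simp add: ceiling_le_iff nat_le_iff)
  define P where "P = {\<sigma>. \<sigma> permutes {..<2 * n}}"
  define W where "W a b \<sigma> \<longleftrightarrow>
    (\<exists>t. find (\<lambda>t. k \<le> t \<and> (\<forall>s<k. \<sigma> t < \<sigma> s)) [a..<b] = Some t \<and> \<sigma> t = 0)" for a b and \<sigma> :: "nat \<Rightarrow> nat"
  have fin: "finite P" by (simp add: P_def finite_permutations)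
  have cardP: "0 < card P" unfolding P_def by (rule card_permutations_pos)
  have reward: "reward T (SOP x) n (steep_instance n) \<sigma> \<le>
      of_bool (W 0 n \<sigma>) + of_bool (W n (2 * n) \<sigma>) + 2 / real n" if "\<sigma> \<in> P" for \<sigma>
  proof -
    from that have "inj \<sigma>" by (simp add: P_def permutes_inj)
    then have "stop1 T (SOP x) n (steep_instance n) \<sigma> =
        find (\<lambda>t. k \<le> t \<and> (\<forall>s<k. \<sigma> t < \<sigma> s)) [0..<n]"
      "stop2 T (SOP x) n (steep_instance n) \<sigma> =
        find (\<lambda>t. k \<le> t \<and> (\<forall>s<k. \<sigma> t < \<sigma> s)) [n..<2 * n]"
      using k assms unfolding k_def
      by (simp_all add: stop1_SOP_steep_instance stop2_SOP_steep_instance)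
    then show ?thesis
      using accepted_value_steep_instance_le[OF assms(2), of \<sigma> "stop1 T (SOP x) n (steep_instance n) \<sigma>"]
        accepted_value_steep_instance_le[OF assms(2), of \<sigma> "stop2 T (SOP x) n (steep_instance n) \<sigma>"]
      unfolding reward_def W_def by simp
  qed
  \<comment> \<open>As \<open>k \<le> n\<close>, the search starts effectively at
    \<open>c = k\<close> in Phase 1 and at \<open>c = n\<close> in Phase 2, which gives the ratios
    \<open>n / k\<close> and \<open>(k + n) / k\<close>.\<close>
  have W1: "real (card {\<sigma> \<in> P. W 0 n \<sigma>}) \<le>
      (1 + real k * ln (real n / real k)) / real (2 * n) * real (card P)"
    using card_find_zero_le[of n "2 * n" k 0] k assms by (simp add: P_def W_def)
  have W2: "real (card {\<sigma> \<in> P. W n (2 * n) \<sigma>}) \<le>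
      (1 + real k * ln (real (k + n) / real k)) / real (2 * n) * real (card P)"
    using card_find_zero_le[of "2 * n" "2 * n" k n] k assms by (simp add: P_def W_def max_absorb1 add.commute)
  have logs: "real k * ln (real n / real k) + real k * ln (real (k + n) / real k) \<le> 0.9 * real n"
  proof (cases "k = 0")
    case False
    define w where "w = real n / real k"
    have "w \<ge> 1" using k False by (simp add: w_def)
    have "real (k + n) / real k = w + 1" using False by (simp add: w_def field_simps)
    then have "real k * ln (real n / real k) + real k * ln (real (k + n) / real k) =
        real k * ln (w * (w + 1))"
      using \<open>w \<ge> 1\<close> by (simp add: ln_mult_pos flip: w_def distrib_left)
    also have "\<dots> \<le> real k * (0.9 * w)"
      using \<open>w \<ge> 1\<close> by (intro mult_left_mono ln_mult_succ_le) auto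
    finally show ?thesis using False by (simp add: w_def)
  qed simp
  have "(\<Sum>\<sigma>\<in>P. reward T (SOP x) n (steep_instance n) \<sigma>) \<le>
      (\<Sum>\<sigma>\<in>P. of_bool (W 0 n \<sigma>) + of_bool (W n (2 * n) \<sigma>) + 2 / real n)"
    by (intro sum_mono reward)
  also have "\<dots> = real (card {\<sigma> \<in> P. W 0 n \<sigma>}) + real (card {\<sigma> \<in> P. W n (2 * n) \<sigma>})
      + 2 / real n * real (card P)"
    using fin by (simp add: sum.distrib sum_of_bool_eq Int_def)
  also have "\<dots> \<le> (1 + real k * ln (real n / real k)) / real (2 * n) * real (card P)
      + (1 + real k * ln (real (k + n) / real k)) / real (2 * n) * real (card P)
      + 2 / real n * real (card P)"
    using W1 W2 by simp
  \<comment> \<open>The error \<open>3 / real n\<close> collects \<open>1 / real (2 * n)\<close>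
    from each counting bound and \<open>1 / real n\<close> per phase for accepting an item other
    than item 0.\<close>
  also have "\<dots> = ((real k * ln (real n / real k) + real k * ln (real (k + n) / real k)) /
      real (2 * n) + 3 / real n) * real (card P)"
    using assms(2) by (simp add: field_simps)
  also have "\<dots> \<le> (0.9 * real n / real (2 * n) + 3 / real n) * real (card P)"
    using logs by (intro mult_right_mono add_right_mono divide_right_mono) auto
  also have "\<dots> = (0.45 + 3 / real n) * real (card P)"
    using assms(2) by simp
  finally show ?thesis
    using cardP unfolding expectation_arrivals by (simp add: P_def divide_le_eq)
qed

lemma one_le_prophet_steep_instance:
  assumes "\<sigma> permutes {..<2 * n}" "0 < n"
  shows "1 \<le> prophet n (steep_instance n) \<sigma>"
proof -
  let ?f = "\<lambda>t. steep_instance n (\<sigma> t)"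
  have nonneg: "0 \<le> Max (?f ` I)" if "finite I" "I \<noteq> {}" for I
    using that steep_instance_pos[of n] by (auto simp: Max_ge_iff less_imp_le)
  have "0 \<in> \<sigma> ` {..<2 * n}" using assms permutes_image[OF assms(1)] by simp
  then obtain t where t: "t < 2 * n" "\<sigma> t = 0" by auto
  then have "1 = ?f t" by (simp add: steep_instance_def)
  then have le: "1 \<le> Max (?f ` I)" if "finite I" "t \<in> I" for I
    using that by (auto intro: Max_ge)
  have "{..<n} \<noteq> {}" "{n..<2 * n} \<noteq> {}" using assms by auto
  note nonneg = nonneg[OF _ this(1)] nonneg[OF _ this(2)]
  show ?thesis
  proof (cases "t < n")
    case True
    then show ?thesis
      using le[of "{..<n}"] nonneg by (auto simp: prophet_def)
  next
    case False
    then show ?thesis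
      using le[of "{n..<2 * n}"] nonneg t by (auto simp: prophet_def)
  qed
qed

lemma one_le_expectation_prophet:
  assumes "0 < n"
  shows "1 \<le> measure_pmf.expectation (arrivals n) (prophet n (steep_instance n))"
proof -
  let ?P = "{\<sigma>. \<sigma> permutes {..<2 * n}}"
  have "real (card ?P) = (\<Sum>\<sigma>\<in>?P. 1)" by simp
  also have "\<dots> \<le> (\<Sum>\<sigma>\<in>?P. prophet n (steep_instance n) \<sigma>)"
    using assms by (intro sum_mono one_le_prophet_steep_instance) auto
  finally show ?thesis
    using card_permutations_pos[of "2 * n"] by (simp add: expectation_arrivals le_divide_eq)
qed

theorem lemma2p1:
  fixes x :: real and T :: tie_rule
  assumes "x \<in> {0..1}" and "is_tie_rule T"
  shows "perf T (SOP x) \<le> ereal 0.450"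
proof -
  have "(INF v\<in>instances n. ereal (measure_pmf.expectation (arrivals n) (reward T (SOP x) n v)
        / measure_pmf.expectation (arrivals n) (prophet n v))) \<le> ereal (0.45 + 3 / real n)"
    if "0 < n" for n
  proof (rule INF_lower2[OF steep_instance_in_instances[OF that]])
    let ?r = "measure_pmf.expectation (arrivals n) (reward T (SOP x) n (steep_instance n))"
    have "0 \<le> ?r"
      by (intro Bochner_Integration.integral_nonneg) (simp add: reward_def accepted_value_steep_instance_nonneg)
    \<comment> \<open>The crude lower bound 1 for the prophet suffices, because the numerator is
      nonnegative.\<close>
    then have "?r / measure_pmf.expectation (arrivals n) (prophet n (steep_instance n)) \<le> ?r / 1"
      using one_le_expectation_prophet[OF that] by (intro divide_left_mono) auto
    also have "\<dots> \<le> 0.45 + 3 / real n"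
      using expectation_reward_SOP_le[OF assms(1) that] by simp
    finally show "ereal (?r / measure_pmf.expectation (arrivals n) (prophet n (steep_instance n)))
      \<le> ereal (0.45 + 3 / real n)" by simp
  qed
  \<comment> \<open>The comparison starts at \<open>n = 1\<close>: \<open>instances 0\<close> is
    empty, so the infimum at 0 is infinite.\<close>
  then have "perf T (SOP x) \<le> liminf (\<lambda>n. ereal (0.45 + 3 / real n))"
    unfolding perf_def by (intro Liminf_mono) (auto simp: eventually_sequentially intro: exI[of _ 1])
  also have "(\<lambda>n. 0.45 + 3 / real n) \<longlonglongrightarrow> 0.45 + 0"
    by (intro tendsto_intros tendsto_divide_0[OF tendsto_const] filterlim_real_at_infinity_sequentially)
  then have "liminf (\<lambda>n. ereal (0.45 + 3 / real n)) = ereal 0.45"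
    by (intro lim_imp_Liminf) auto
  finally show ?thesis by simp
qed

end
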